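(* Let $\mathcal{X}$ be a standard Borel space, let $\pi(\cdot\mid x)$ be a Markov kernel on $\mathcal{X}$, and let $Q_0$ be a probability distribution on $\mathcal{X}$ that is stationary for $\pi$. Then each of the following kernels $P$ is a forward--backward probability kernel relative to $Q_0$: (1) $P=\pi^{s}$, where $s=2r$ for an integer $r\ge1$, provided the Markov chain with kernel $\pi$ and stationary distribution $Q_0$ is reversible; (2) $P=\pi^{r}\circ\pi^{-r}$, for any integer $r\ge1$ (reversibility not assumed); (3) $P=[\pi^{-1}\circ\pi]^{r}$, for any integer $r\ge1$ (reversibility not assumed).
   Context: For a Markov kernel $\pi$ with stationary distribution $Q_0$, $\pi^s$ denotes the kernel for taking $s$ steps of the chain. $\pi^{-1}$ denotes the kernel of the reverse chain, i.e. if $X\sim Q_0$ and $X'\mid X\sim\pi(\cdot\mid X)$, then $\pi^{-1}(\cdot\mid X')$ is the conditional distribution of $X$ given $X'$ (defined $Q_0$-almost everywhere); $\pi^{-s}$ denotes taking $s$ steps of the reverse chain. The chain is reversible if $\pi=\pi^{-1}$ ($Q_0$-a.e.). Compositions are read right to left: $\pi^r\circ\pi^{-r}$ means first take $r$ steps backward, then $r$ steps forward; $\pi^{-1}\circ\pi$ means first take one step forward, then one step backward, and $[\pi^{-1}\circ\pi]^r$ repeats this $r$ times. A probability kernel $P$ from $\mathcal{X}$ to $\mathcal{X}$ is called a \emph{forward--backward probability kernel relative to $Q_0$} if the following holds: if $X\sim Q_0$ and $X'\mid X\sim P(\cdot\mid X)$, then there exists a random variable $Y$ (taking values in some measurable space,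 defined jointly with $(X,X')$, possibly on an enlarged probability space) such that $X$ and $X'$ are conditionally i.i.d. given $Y$. *)

theory Defs
  imports "HOL-Probability.Probability"
begin

definition standard_borel :: "'a measure \<Rightarrow> bool" where
  "standard_borel M \<longleftrightarrow>
     (\<exists>T. topspace T = space M \<and> completely_metrizable_space T \<and> second_countable T \<and>
          sets M = sigma_sets (topspace T) {U. openin T U})"

definition markov_kernel :: "'a measure \<Rightarrow> ('a \<Rightarrow> 'a measure) \<Rightarrow> bool" where
  "markov_kernel M K \<longleftrightarrow> K \<in> M \<rightarrow>\<^sub>M prob_algebra M"

definition stationary :: "'a measure \<Rightarrow> ('a \<Rightarrow> 'a measure) \<Rightarrow> 'a measure \<Rightarrow> bool" where
  "stationary M K Q \<longleftrightarrow> Q \<in> space (prob_algebra M) \<and> Q \<bind> K = Q"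

(* Read right to left: first a step of K, then a step of L. *)
definition kernel_comp :: "('a \<Rightarrow> 'a measure) \<Rightarrow> ('a \<Rightarrow> 'a measure) \<Rightarrow> 'a \<Rightarrow> 'a measure" where
  "kernel_comp L K = (\<lambda>x. K x \<bind> L)"

primrec kernel_pow :: "'a measure \<Rightarrow> ('a \<Rightarrow> 'a measure) \<Rightarrow> nat \<Rightarrow> 'a \<Rightarrow> 'a measure" where
  "kernel_pow M K 0 = return M"
| "kernel_pow M K (Suc n) = kernel_comp K (kernel_pow M K n)"

(* The law of (X, X') when X ~ Q and X' | X ~ K(. | X). *)
definition joint_law :: "'a measure \<Rightarrow> 'a measure \<Rightarrow> ('a \<Rightarrow> 'a measure) \<Rightarrow> ('a \<times> 'a) measure" where
  "joint_law M Q K = Q \<bind> (\<lambda>x. K x \<bind> (\<lambda>x'. return (M \<Otimes>\<^sub>M M) (x, x')))"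

(* L is a version of the conditional distribution of X given X', where (X, X') ~ joint_law M Q K:
   since X' ~ Q when Q is stationary, this says that (X', X) ~ joint_law M Q L.
   Such an L is determined only up to Q-null sets, hence a predicate rather than a function. *)
definition reverse_kernel ::
    "'a measure \<Rightarrow> 'a measure \<Rightarrow> ('a \<Rightarrow> 'a measure) \<Rightarrow> ('a \<Rightarrow> 'a measure) \<Rightarrow> bool" where
  "reverse_kernel M Q K L \<longleftrightarrow>
     markov_kernel M L \<and>
     distr (joint_law M Q K) (M \<Otimes>\<^sub>M M) (\<lambda>(x, x'). (x', x)) = joint_law M Q L"

definition reversible :: "'a measure \<Rightarrow> 'a measure \<Rightarrow> ('a \<Rightarrow> 'a measure) \<Rightarrow> bool" where
  "reversible M Q K \<longleftrightarrow> (\<exists>L. reverse_kernel M Q K L \<and> (AE x in Q. K x = L x))"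

definition cond_iid ::
    "'w measure \<Rightarrow> 'a measure \<Rightarrow> 'y measure \<Rightarrow> ('w \<Rightarrow> 'a) \<Rightarrow> ('w \<Rightarrow> 'a) \<Rightarrow> ('w \<Rightarrow> 'y) \<Rightarrow> bool" where
  "cond_iid \<Omega> M N X X' Y \<longleftrightarrow>
     X \<in> \<Omega> \<rightarrow>\<^sub>M M \<and> X' \<in> \<Omega> \<rightarrow>\<^sub>M M \<and> Y \<in> \<Omega> \<rightarrow>\<^sub>M N \<and>
     (let E = real_cond_exp \<Omega> (vimage_algebra (space \<Omega>) Y N) in
      (\<forall>A\<in>sets M. \<forall>B\<in>sets M. AE \<omega> in \<Omega>.
         E (\<lambda>\<omega>. indicator A (X \<omega>) * indicator B (X' \<omega>)) \<omega> =
         E (\<lambda>\<omega>. indicator A (X \<omega>)) \<omega> * E (\<lambda>\<omega>. indicator B (X' \<omega>)) \<omega>) \<and>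
      (\<forall>A\<in>sets M. AE \<omega> in \<Omega>.
         E (\<lambda>\<omega>. indicator A (X \<omega>)) \<omega> = E (\<lambda>\<omega>. indicator A (X' \<omega>)) \<omega>))"

(* \<Omega> ranges over the enlargements of the space carrying (X, X').  A definition cannot quantify over
   the types of \<Omega> and of the values of Y, so both are fixed.  On a standard Borel space this loses
   nothing: Y can be replaced by the common conditional distribution of X and X' given Y, which is
   a random element of prob_algebra M, and \<Omega> by the law of (X, X', Y). *)
definition forward_backward_kernel ::
    "'a measure \<Rightarrow> 'a measure \<Rightarrow> ('a \<Rightarrow> 'a measure) \<Rightarrow> bool" where
  "forward_backward_kernel M Q P \<longleftrightarrow>
     markov_kernel M P \<and>
     (\<exists>(\<Omega> :: ('a \<times> 'a \<times> 'a measure) measure) X X' (N :: 'a measure measure) Y.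
        prob_space \<Omega> \<and> X \<in> \<Omega> \<rightarrow>\<^sub>M M \<and> X' \<in> \<Omega> \<rightarrow>\<^sub>M M \<and>
        distr \<Omega> (M \<Otimes>\<^sub>M M) (\<lambda>\<omega>. (X \<omega>, X' \<omega>)) = joint_law M Q P \<and>
        cond_iid \<Omega> M N X X' Y)"

end

(* If K and L are adjoint for the pairing of f and g given by the Q-integral of f g, and P is K
   followed by L, then Q(dx) P(x, dx') is the mixture of L(y, dx) L(y, dx') over y ~ Q: given y, the
   points X and X' are i.i.d. with law L(y, .), and Y may be taken to be this law itself.  So it
   suffices to factor each kernel as L o K with K and L adjoint.  Reversal of time is taking
   adjoints, hence pi^r and pi^-r are adjoint, and S = pi^-1 o pi is self-adjoint.  An even power of
   S is S^k o S^k, and the odd power with exponent 2k + 1 is (S^k o pi^-1) o (pi o S^k). *)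
theory Submission
  imports Defs
begin

section \<open>Measures on products, and the algebra of Markov kernels\<close>

text \<open>Rectangles are closed under intersection and generate the product sigma-algebra. The
  whole space is itself a rectangle of finite measure, so a constant sequence serves as the
  exhaustion.\<close>

lemma emeasure_eq_on_rectanglesI:
  assumes sets: "sets P = sets (M \<Otimes>\<^sub>M N)" "sets P' = sets (M \<Otimes>\<^sub>M N)"
    and fin: "finite_measure P"
    and eq: "\<And>A B. A \<in> sets M \<Longrightarrow> B \<in> sets N \<Longrightarrow> emeasure P (A \<times> B) = emeasure P' (A \<times> B)"
  shows "P = P'"
proof (rule measure_eqI_generator_eq[OF Int_stable_pair_measure_generator[of M N]])
  show "{a \<times> b |a b. a \<in> sets M \<and> b \<in> sets N} \<subseteq> Pow (space M \<times> space N)"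
    using sets.sets_into_space[of _ M] sets.sets_into_space[of _ N] by blast
  show "sets P = sigma_sets (space M \<times> space N) {a \<times> b |a b. a \<in> sets M \<and> b \<in> sets N}"
    "sets P' = sigma_sets (space M \<times> space N) {a \<times> b |a b. a \<in> sets M \<and> b \<in> sets N}"
    by (simp_all add: sets sets_pair_measure)
  show "range (\<lambda>_::nat. space M \<times> space N) \<subseteq> {a \<times> b |a b. a \<in> sets M \<and> b \<in> sets N}"
    by blast
  show "emeasure P (space M \<times> space N) \<noteq> \<infinity>"
    using finite_measure.emeasure_finite[OF fin] by simp
qed (use eq in auto)

lemma prob_algebra_memD:
  assumes "Q \<in> space (prob_algebra M)"
  shows "prob_space Q" "sets Q = sets M" "space Q = space M" "space Q \<noteq> {}"
  using assms prob_space.not_empty sets_eq_imp_space_eq by (auto simp: space_prob_algebra)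

lemma markov_kernelD:
  assumes "markov_kernel M K"
  shows "K \<in> M \<rightarrow>\<^sub>M prob_algebra M" "K \<in> M \<rightarrow>\<^sub>M subprob_algebra M"
    and "x \<in> space M \<Longrightarrow> K x \<in> space (prob_algebra M)"
  using assms measurable_space[of K M "prob_algebra M"]
  by (auto simp: markov_kernel_def intro: measurable_prob_algebraD)

lemma sets_markov_kernel: "markov_kernel M K \<Longrightarrow> x \<in> space M \<Longrightarrow> sets (K x) = sets M"
  by (rule prob_algebra_memD(2)[OF markov_kernelD(3)])

lemma markov_kernel_cong:
  assumes "\<And>x. x \<in> space M \<Longrightarrow> K x = K' x"
  shows "markov_kernel M K \<longleftrightarrow> markov_kernel M K'"
  unfolding markov_kernel_def by (rule measurable_cong) (use assms in auto)

lemma markov_kernel_comp: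
  assumes "markov_kernel M K" "markov_kernel M L"
  shows "markov_kernel M (kernel_comp L K)"
  using assms unfolding markov_kernel_def kernel_comp_def by (rule measurable_bind_prob_space)

lemma markov_kernel_pow: "markov_kernel M K \<Longrightarrow> markov_kernel M (kernel_pow M K n)"
proof (induction n)
  case 0
  show ?case by (simp add: markov_kernel_def)
qed (simp add: markov_kernel_comp)

lemma measurable_nn_integral_markov_kernel:
  assumes "markov_kernel M K" "f \<in> borel_measurable M"
  shows "(\<lambda>x. \<integral>\<^sup>+y. f y \<partial>K x) \<in> borel_measurable M"
  using markov_kernelD(2)[OF assms(1)] nn_integral_measurable_subprob_algebra[OF assms(2)]
  by (rule measurable_compose)

lemma nn_integral_kernel_comp:
  assumes "markov_kernel M K" "markov_kernel M L" "f \<in> borel_measurable M" "x \<in> space M"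
  shows "(\<integral>\<^sup>+y. f y \<partial>kernel_comp L K x) = (\<integral>\<^sup>+y. \<integral>\<^sup>+z. f z \<partial>L y \<partial>K x)"
proof -
  have "L \<in> K x \<rightarrow>\<^sub>M subprob_algebra M"
    using markov_kernelD(2)[OF assms(2)] sets_markov_kernel[OF assms(1,4)]
    by (simp cong: measurable_cong_sets)
  then show ?thesis
    unfolding kernel_comp_def by (rule nn_integral_bind[OF assms(3)])
qed

text \<open>This is associativity of \<open>bind\<close>. It is claimed only on
  \<open>space M\<close>, since a kernel may take arbitrary values elsewhere; other equations
  between kernels are pointwise for the same reason.\<close>

lemma kernel_comp_assoc:
  assumes "markov_kernel M J" "markov_kernel M K" "markov_kernel M L" "x \<in> space M"
  shows "kernel_comp (kernel_comp L K) J x = kernel_comp L (kernel_comp K J) x"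
proof -
  have "K \<in> J x \<rightarrow>\<^sub>M subprob_algebra M"
    using markov_kernelD(2)[OF assms(2)] sets_markov_kernel[OF assms(1,4)]
    by (simp cong: measurable_cong_sets)
  then show ?thesis
    unfolding kernel_comp_def using markov_kernelD(2)[OF assms(3)] by (rule bind_assoc[symmetric])
qed

text \<open>Allows rewriting inside a composition when the new factor is known only on
  \<open>space M\<close>, which is the space of \<open>K x\<close>.\<close>

lemma kernel_comp_cong:
  assumes "markov_kernel M K" "x \<in> space M" "K x = K' x"
    and "\<And>y. y \<in> space M \<Longrightarrow> L y = L' y"
  shows "kernel_comp L K x = kernel_comp L' K' x"
  unfolding kernel_comp_def assms(3)[symmetric]
  by (rule bind_cong)
    (use prob_algebra_memD(3)[OF markov_kernelD(3)[OF assms(1,2)]] assms(4) in auto)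

lemma kernel_pow_add:
  assumes K: "markov_kernel M K" and x: "x \<in> space M"
  shows "kernel_pow M K (m + n) x = kernel_comp (kernel_pow M K m) (kernel_pow M K n) x"
proof (induction m)
  case 0
  show ?case
    using sets_markov_kernel[OF markov_kernel_pow[OF K] x, of n]
    by (simp add: kernel_comp_def bind_return'')
next
  case (Suc m)
  have "kernel_pow M K (Suc m + n) x
      = kernel_comp K (kernel_comp (kernel_pow M K m) (kernel_pow M K n)) x"
    using Suc by (simp add: kernel_comp_def)
  also have "\<dots> = kernel_comp (kernel_pow M K (Suc m)) (kernel_pow M K n) x"
    using kernel_comp_assoc[OF markov_kernel_pow[OF K] markov_kernel_pow[OF K] K x] by simp
  finally show ?case .
qed

lemma kernel_pow_1:
  assumes "markov_kernel M K" "x \<in> space M"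
  shows "kernel_pow M K 1 x = K x"
  using bind_return[OF markov_kernelD(2)[OF assms(1)] assms(2)] by (simp add: kernel_comp_def)

text \<open>The definition of powers adds the new step last; here it comes first. Taking adjoints
  reverses the order of steps, so both forms are needed.\<close>

lemma kernel_pow_Suc_right:
  assumes K: "markov_kernel M K" and x: "x \<in> space M"
  shows "kernel_pow M K (Suc n) x = kernel_comp (kernel_pow M K n) K x"
  using kernel_pow_add[OF K x, of n 1] kernel_pow_1[OF K x] by (simp add: kernel_comp_def)

section \<open>The joint law of a starting point and the next state\<close>

context
  fixes M Q :: "'a measure" and K :: "'a \<Rightarrow> 'a measure"
  assumes Q: "Q \<in> space (prob_algebra M)" and K: "markov_kernel M K"
begin

lemma measurable_joint_law_kernel:
  "(\<lambda>x. K x \<bind> (\<lambda>y. return (M \<Otimes>\<^sub>M M) (x, y))) \<in> M \<rightarrow>\<^sub>M prob_algebra (M \<Otimes>\<^sub>M M)"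
  by (rule measurable_bind_prob_space2[OF markov_kernelD(1)[OF K]]) simp

lemma joint_law_in_prob_algebra: "joint_law M Q K \<in> space (prob_algebra (M \<Otimes>\<^sub>M M))"
  using prob_space_bind'[OF Q measurable_joint_law_kernel] sets_bind'[OF Q measurable_joint_law_kernel]
  by (simp add: space_prob_algebra joint_law_def)

text \<open>Both binds in \<open>joint_law\<close> are unfolded, the outer one over \<open>Q\<close>
  and the inner one for each fixed x; the remaining Dirac measure just evaluates \<open>f\<close> at
  (x, y).\<close>

lemma nn_integral_joint_law:
  assumes f: "f \<in> borel_measurable (M \<Otimes>\<^sub>M M)"
  shows "(\<integral>\<^sup>+p. f p \<partial>joint_law M Q K) = (\<integral>\<^sup>+x. \<integral>\<^sup>+y. f (x, y) \<partial>K x \<partial>Q)"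
proof -
  note setsQ [measurable_cong] = prob_algebra_memD(2)[OF Q]
  have "(\<integral>\<^sup>+p. f p \<partial>joint_law M Q K)
      = (\<integral>\<^sup>+x. \<integral>\<^sup>+p. f p \<partial>(K x \<bind> (\<lambda>y. return (M \<Otimes>\<^sub>M M) (x, y))) \<partial>Q)"
    unfolding joint_law_def
    by (rule nn_integral_bind[OF f])
      (use measurable_prob_algebraD[OF measurable_joint_law_kernel] setsQ in
        \<open>simp cong: measurable_cong_sets\<close>)
  also have "\<dots> = (\<integral>\<^sup>+x. \<integral>\<^sup>+y. f (x, y) \<partial>K x \<partial>Q)"
  proof (rule nn_integral_cong)
    fix x assume "x \<in> space Q"
    then have x: "x \<in> space M" by (simp add: prob_algebra_memD(3)[OF Q])
    note sets = prob_algebra_memD(2,3)[OF markov_kernelD(3)[OF K x]]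
    have "(\<lambda>y. return (M \<Otimes>\<^sub>M M) (x, y)) \<in> K x \<rightarrow>\<^sub>M subprob_algebra (M \<Otimes>\<^sub>M M)"
      using x by (simp add: sets cong: measurable_cong_sets)
    then have "(\<integral>\<^sup>+p. f p \<partial>(K x \<bind> (\<lambda>y. return (M \<Otimes>\<^sub>M M) (x, y))))
        = (\<integral>\<^sup>+y. \<integral>\<^sup>+p. f p \<partial>return (M \<Otimes>\<^sub>M M) (x, y) \<partial>K x)"
      by (rule nn_integral_bind[OF f])
    also have "\<dots> = (\<integral>\<^sup>+y. f (x, y) \<partial>K x)"
      using x by (intro nn_integral_cong nn_integral_return)
        (auto simp: sets space_pair_measure f)
    finally show "(\<integral>\<^sup>+p. f p \<partial>(K x \<bind> (\<lambda>y. return (M \<Otimes>\<^sub>M M) (x, y)))) = (\<integral>\<^sup>+y. f (x, y) \<partial>K x)" .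
  qed
  finally show ?thesis .
qed

text \<open>Rectangles determine the joint law, so this is the form in which it is later compared
  with a mixture of product measures.\<close>

lemma emeasure_joint_law_Times:
  assumes [measurable]: "A \<in> sets M" "B \<in> sets M"
  shows "emeasure (joint_law M Q K) (A \<times> B) = (\<integral>\<^sup>+x. indicator A x * emeasure (K x) B \<partial>Q)"
proof -
  have "emeasure (joint_law M Q K) (A \<times> B)
      = (\<integral>\<^sup>+p. indicator A (fst p) * indicator B (snd p) \<partial>joint_law M Q K)"
    using prob_algebra_memD(2)[OF joint_law_in_prob_algebra]
    by (simp flip: nn_integral_indicator indicator_times)
  also have "\<dots> = (\<integral>\<^sup>+x. \<integral>\<^sup>+y. indicator A x * indicator B y \<partial>K x \<partial>Q)"
    by (subst nn_integral_joint_law) auto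
  also have "\<dots> = (\<integral>\<^sup>+x. indicator A x * emeasure (K x) B \<partial>Q)"
  proof (rule nn_integral_cong)
    fix x assume "x \<in> space Q"
    then have [measurable_cong]: "sets (K x) = sets M"
      using K by (simp add: sets_markov_kernel prob_algebra_memD(3)[OF Q])
    show "(\<integral>\<^sup>+y. indicator A x * indicator B y \<partial>K x) = indicator A x * emeasure (K x) B"
      by (simp add: nn_integral_cmult)
  qed
  finally show ?thesis .
qed

end

section \<open>Kernels adjoint with respect to \<open>Q\<close>\<close>

text \<open>Testing with nonnegative extended-valued functions avoids every integrability condition.
  Testing with functions instead of sets makes composition easy, since a kernel applied to a test
  function is again a test function.\<close>

definition adjoint_kernels ::
    "'a measure \<Rightarrow> 'a measure \<Rightarrow> ('a \<Rightarrow> 'a measure) \<Rightarrow> ('a \<Rightarrow> 'a measure) \<Rightarrow> bool" where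
  "adjoint_kernels M Q K L \<longleftrightarrow> markov_kernel M K \<and> markov_kernel M L \<and>
     (\<forall>f\<in>borel_measurable M. \<forall>g\<in>borel_measurable M.
        (\<integral>\<^sup>+x. f x * (\<integral>\<^sup>+y. g y \<partial>K x) \<partial>Q) = (\<integral>\<^sup>+y. (\<integral>\<^sup>+x. f x \<partial>L y) * g y \<partial>Q))"

lemma adjoint_kernelsD:
  assumes "adjoint_kernels M Q K L"
  shows "markov_kernel M K" "markov_kernel M L"
    and "f \<in> borel_measurable M \<Longrightarrow> g \<in> borel_measurable M \<Longrightarrow>
      (\<integral>\<^sup>+x. f x * (\<integral>\<^sup>+y. g y \<partial>K x) \<partial>Q) = (\<integral>\<^sup>+y. (\<integral>\<^sup>+x. f x \<partial>L y) * g y \<partial>Q)"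
  using assms by (auto simp: adjoint_kernels_def)

lemma adjoint_kernels_sym: "adjoint_kernels M Q K L \<Longrightarrow> adjoint_kernels M Q L K"
  by (auto simp: adjoint_kernels_def mult.commute)

text \<open>The second kernel enters only under an integral over \<open>Q\<close>, so changing it on
  a null set is invisible. This copes with reverse kernels being determined only almost
  everywhere.\<close>

lemma adjoint_kernels_cong_AE:
  assumes "adjoint_kernels M Q K L" "markov_kernel M L'" "AE x in Q. L' x = L x"
  shows "adjoint_kernels M Q K L'"
proof -
  have "(\<integral>\<^sup>+y. (\<integral>\<^sup>+x. f x \<partial>L y) * g y \<partial>Q) = (\<integral>\<^sup>+y. (\<integral>\<^sup>+x. f x \<partial>L' y) * g y \<partial>Q)" for f g
    using assms(3) by (intro nn_integral_cong_AE) auto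
  then show ?thesis using assms(1,2) by (simp add: adjoint_kernels_def)
qed

text \<open>As for operators, the adjoint of a product is the product of the adjoints in reverse
  order. The kernels are moved across the pairing one at a time: first \<open>K\<close>, with
  \<open>K'\<close> applied to g as test function, then \<open>K'\<close>, with \<open>L\<close>
  applied to f.\<close>

lemma adjoint_kernels_comp:
  assumes Q: "Q \<in> space (prob_algebra M)"
    and a: "adjoint_kernels M Q K L" and b: "adjoint_kernels M Q K' L'"
  shows "adjoint_kernels M Q (kernel_comp K' K) (kernel_comp L L')"
proof -
  note K = adjoint_kernelsD(1,2)[OF a] and K' = adjoint_kernelsD(1,2)[OF b]
  have "(\<integral>\<^sup>+x. f x * (\<integral>\<^sup>+y. g y \<partial>kernel_comp K' K x) \<partial>Q)
      = (\<integral>\<^sup>+y. (\<integral>\<^sup>+x. f x \<partial>kernel_comp L L' y) * g y \<partial>Q)"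
    if f: "f \<in> borel_measurable M" and g: "g \<in> borel_measurable M" for f g
  proof -
    have "(\<integral>\<^sup>+x. f x * (\<integral>\<^sup>+y. g y \<partial>kernel_comp K' K x) \<partial>Q)
        = (\<integral>\<^sup>+x. f x * (\<integral>\<^sup>+y. \<integral>\<^sup>+z. g z \<partial>K' y \<partial>K x) \<partial>Q)"
      by (intro nn_integral_cong)
        (simp add: nn_integral_kernel_comp[OF K(1) K'(1) g] prob_algebra_memD(3)[OF Q])
    also have "\<dots> = (\<integral>\<^sup>+y. (\<integral>\<^sup>+x. f x \<partial>L y) * (\<integral>\<^sup>+z. g z \<partial>K' y) \<partial>Q)"
      by (rule adjoint_kernelsD(3)[OF a f measurable_nn_integral_markov_kernel[OF K'(1) g]])
    also have "\<dots> = (\<integral>\<^sup>+z. (\<integral>\<^sup>+y. \<integral>\<^sup>+x. f x \<partial>L y \<partial>L' z) * g z \<partial>Q)"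
      by (rule adjoint_kernelsD(3)[OF b measurable_nn_integral_markov_kernel[OF K(2) f] g])
    also have "\<dots> = (\<integral>\<^sup>+y. (\<integral>\<^sup>+x. f x \<partial>kernel_comp L L' y) * g y \<partial>Q)"
      by (intro nn_integral_cong)
        (simp add: nn_integral_kernel_comp[OF K'(2) K(2) f] prob_algebra_memD(3)[OF Q])
    finally show ?thesis .
  qed
  then show ?thesis
    using markov_kernel_comp[OF K(1) K'(1)] markov_kernel_comp[OF K'(2) K(2)]
    by (simp add: adjoint_kernels_def)
qed

lemma adjoint_kernels_return:
  assumes Q: "Q \<in> space (prob_algebra M)"
  shows "adjoint_kernels M Q (return M) (return M)"
proof -
  have "(\<integral>\<^sup>+x. f x * (\<integral>\<^sup>+y. g y \<partial>return M x) \<partial>Q) = (\<integral>\<^sup>+y. (\<integral>\<^sup>+x. f x \<partial>return M y) * g y \<partial>Q)"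
    if "f \<in> borel_measurable M" "g \<in> borel_measurable M" for f g
    using that by (intro nn_integral_cong) (simp add: nn_integral_return prob_algebra_memD(3)[OF Q])
  then show ?thesis by (simp add: adjoint_kernels_def markov_kernel_def)
qed

lemma adjoint_kernels_pow:
  assumes Q: "Q \<in> space (prob_algebra M)" and a: "adjoint_kernels M Q K L"
  shows "adjoint_kernels M Q (kernel_pow M K n) (kernel_pow M L n)"
proof (induction n)
  case 0
  show ?case by (simp add: adjoint_kernels_return[OF Q])
next
  case (Suc n)
  note L = adjoint_kernelsD(2)[OF a]
  \<comment> \<open>The composition lemma yields \<open>L\<close> first and then n steps of
    \<open>L\<close>, whereas the power is defined by adding \<open>L\<close> last. The two agree on
    the whole space, hence almost everywhere.\<close>
  have "AE x in Q. kernel_pow M L (Suc n) x = kernel_comp (kernel_pow M L n) L x"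
    by (rule AE_I2) (simp only: kernel_pow_Suc_right[OF L] prob_algebra_memD(3)[OF Q])
  with adjoint_kernels_comp[OF Q Suc a] markov_kernel_pow[OF L] show ?case
    unfolding kernel_pow.simps(2)[of M K] by (rule adjoint_kernels_cong_AE)
qed

text \<open>Each side of the pairing is the integral of a product f(x) g(x') against a joint law,
  and reversal says that the two joint laws are mirror images.\<close>

lemma reverse_kernel_imp_adjoint:
  assumes Q: "Q \<in> space (prob_algebra M)" and K: "markov_kernel M K"
    and rev: "reverse_kernel M Q K L"
  shows "adjoint_kernels M Q K L"
proof -
  have L: "markov_kernel M L" using rev by (simp add: reverse_kernel_def)
  note setsQ [measurable_cong] = prob_algebra_memD(2)[OF Q]
  note [measurable_cong] = prob_algebra_memD(2)[OF joint_law_in_prob_algebra[OF Q K]]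
  have "(\<integral>\<^sup>+x. f x * (\<integral>\<^sup>+y. g y \<partial>K x) \<partial>Q) = (\<integral>\<^sup>+y. (\<integral>\<^sup>+x. f x \<partial>L y) * g y \<partial>Q)"
    if [measurable]: "f \<in> borel_measurable M" "g \<in> borel_measurable M" for f g
  proof -
    have sets: "sets (K x) = sets M" "sets (L x) = sets M" if "x \<in> space Q" for x
      using that K L by (simp_all add: sets_markov_kernel prob_algebra_memD(3)[OF Q])
    have "(\<integral>\<^sup>+x. f x * (\<integral>\<^sup>+y. g y \<partial>K x) \<partial>Q) = (\<integral>\<^sup>+x. \<integral>\<^sup>+y. f x * g y \<partial>K x \<partial>Q)"
      by (intro nn_integral_cong nn_integral_cmult[symmetric])
        (simp add: sets cong: measurable_cong_sets)
    also have "\<dots> = (\<integral>\<^sup>+p. f (fst p) * g (snd p) \<partial>joint_law M Q K)"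
      by (subst nn_integral_joint_law[OF Q K]) auto
    \<comment> \<open>The swap of coordinates exchanges the arguments of f and g, so that the law on
      the right is the one occurring in \<open>reverse_kernel\<close>.\<close>
    also have "\<dots> = (\<integral>\<^sup>+p. f (snd p) * g (fst p)
        \<partial>distr (joint_law M Q K) (M \<Otimes>\<^sub>M M) (\<lambda>(x, x'). (x', x)))"
      by (subst nn_integral_distr) (auto simp: case_prod_beta)
    also have "\<dots> = (\<integral>\<^sup>+p. f (snd p) * g (fst p) \<partial>joint_law M Q L)"
      using rev by (simp add: reverse_kernel_def)
    also have "\<dots> = (\<integral>\<^sup>+y. \<integral>\<^sup>+x. f x * g y \<partial>L y \<partial>Q)"
      by (subst nn_integral_joint_law[OF Q L]) auto
    also have "\<dots> = (\<integral>\<^sup>+y. (\<integral>\<^sup>+x. f x \<partial>L y) * g y \<partial>Q)"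
      by (intro nn_integral_cong nn_integral_multc) (simp add: sets cong: measurable_cong_sets)
    finally show ?thesis .
  qed
  then show ?thesis using K L by (simp add: adjoint_kernels_def)
qed

section \<open>Conditional expectations given Y and conditional independence\<close>

text \<open>Every event of the sigma-algebra generated by Y is a preimage of some D, so testing on
  these events characterises the conditional expectation. The bounds by 0 and 1 give integrability
  and let the test be stated with nonnegative integrals.\<close>

lemma real_cond_exp_vimage_algebraI:
  fixes f :: "'w \<Rightarrow> real" and h :: "'y \<Rightarrow> real"
  assumes \<Omega>: "prob_space \<Omega>" and Y [measurable]: "Y \<in> \<Omega> \<rightarrow>\<^sub>M N"
    and [measurable]: "f \<in> borel_measurable \<Omega>" "h \<in> borel_measurable N"
    and f: "\<And>\<omega>. 0 \<le> f \<omega>" "\<And>\<omega>. f \<omega> \<le> 1" and h: "\<And>y. 0 \<le> h y" "\<And>y. h y \<le> 1"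
    and eq: "\<And>D. D \<in> sets N \<Longrightarrow>
      (\<integral>\<^sup>+\<omega>. ennreal (f \<omega>) * indicator D (Y \<omega>) \<partial>\<Omega>) =
      (\<integral>\<^sup>+\<omega>. ennreal (h (Y \<omega>)) * indicator D (Y \<omega>) \<partial>\<Omega>)"
  shows "AE \<omega> in \<Omega>. real_cond_exp \<Omega> (vimage_algebra (space \<Omega>) Y N) f \<omega> = h (Y \<omega>)"
proof -
  let ?F = "vimage_algebra (space \<Omega>) Y N"
  interpret prob_space \<Omega> by fact
  have Y_space: "Y \<in> space \<Omega> \<rightarrow> space N" using measurable_space[OF Y] by auto
  have "subalgebra \<Omega> ?F"
    using Y by (auto simp: subalgebra_def sets_vimage_algebra2[OF Y_space])
  then interpret finite_measure_subalgebra \<Omega> ?F by unfold_locales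
  show ?thesis
  proof (rule real_cond_exp_charact)
    show "integrable \<Omega> f" "integrable \<Omega> (\<lambda>\<omega>. h (Y \<omega>))"
      using f h by (auto intro!: integrable_const_bound[where B = 1])
    show "(\<lambda>\<omega>. h (Y \<omega>)) \<in> borel_measurable ?F"
      by (rule measurable_compose[OF measurable_vimage_algebra1[OF Y_space]]) simp
    fix A assume "A \<in> sets ?F"
    then obtain D where D [measurable]: "D \<in> sets N" and A: "A = Y -` D \<inter> space \<Omega>"
      by (auto simp: sets_vimage_algebra2[OF Y_space])
    have "(\<integral>\<omega>\<in>A. f \<omega> \<partial>\<Omega>) = (\<integral>\<omega>. f \<omega> * indicator D (Y \<omega>) \<partial>\<Omega>)"
      unfolding set_lebesgue_integral_def A
      by (intro Bochner_Integration.integral_cong) (auto split: split_indicator)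
    \<comment> \<open>Both integrands are nonnegative, so the Bochner integrals are read off from
      the nonnegative integrals in \<open>eq\<close>.\<close>
    also have "\<dots> = (\<integral>\<omega>. h (Y \<omega>) * indicator D (Y \<omega>) \<partial>\<Omega>)"
      using eq[OF D] f(1) h(1)
      by (simp add: integral_eq_nn_integral ennreal_mult ennreal_indicator)
    also have "\<dots> = (\<integral>\<omega>\<in>A. h (Y \<omega>) \<partial>\<Omega>)"
      unfolding set_lebesgue_integral_def A
      by (intro Bochner_Integration.integral_cong) (auto split: split_indicator)
    finally show "(\<integral>\<omega>\<in>A. f \<omega> \<partial>\<Omega>) = (\<integral>\<omega>\<in>A. h (Y \<omega>) \<partial>\<Omega>)" .
  qed
qed

text \<open>The hypothesis \<open>eq\<close> says that, given Y, the pair (X, X') has the product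
  law of \<open>\<kappa> Y\<close> with itself. Hence the conditional probabilities are values of
  \<open>\<kappa> Y\<close>, and both required identities can be read off from them.\<close>

lemma cond_iidI:
  assumes \<Omega>: "prob_space \<Omega>"
    and X [measurable]: "X \<in> \<Omega> \<rightarrow>\<^sub>M M" and X' [measurable]: "X' \<in> \<Omega> \<rightarrow>\<^sub>M M"
    and Y [measurable]: "Y \<in> \<Omega> \<rightarrow>\<^sub>M N" and \<kappa>: "\<kappa> \<in> N \<rightarrow>\<^sub>M prob_algebra M"
    and eq: "\<And>A B D. A \<in> sets M \<Longrightarrow> B \<in> sets M \<Longrightarrow> D \<in> sets N \<Longrightarrow>
      emeasure \<Omega> {\<omega> \<in> space \<Omega>. X \<omega> \<in> A \<and> X' \<omega> \<in> B \<and> Y \<omega> \<in> D} =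
      (\<integral>\<^sup>+\<omega>. emeasure (\<kappa> (Y \<omega>)) A * emeasure (\<kappa> (Y \<omega>)) B * indicator D (Y \<omega>) \<partial>\<Omega>)"
  shows "cond_iid \<Omega> M N X X' Y"
proof -
  let ?E = "real_cond_exp \<Omega> (vimage_algebra (space \<Omega>) Y N)"
  \<comment> \<open>The default 0 outside \<open>N\<close> makes the bounds 0 and 1 hold for every
    argument, as the criterion for conditional expectations demands.\<close>
  define h where "h A y = (if y \<in> space N then measure (\<kappa> y) A else 0)" for A y
  have prob: "prob_space (\<kappa> y)" "sets (\<kappa> y) = sets M" "space (\<kappa> y) = space M"
    if "y \<in> space N" for y
    using prob_algebra_memD[OF measurable_space[OF \<kappa> that]] by auto
  have Y_space: "Y \<omega> \<in> space N" if "\<omega> \<in> space \<Omega>" for \<omega>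
    using measurable_space[OF Y that] .
  have h_meas [measurable]: "h A \<in> borel_measurable N" if "A \<in> sets M" for A
    using measurable_compose[OF \<kappa> measurable_measure_prob_algebra[OF that]]
    by (simp add: h_def cong: measurable_cong)
  have h: "0 \<le> h A y" "h A y \<le> 1" for A y
    using prob_space.prob_le_1[OF prob(1)] by (auto simp: h_def)
  \<comment> \<open>The hypothesis \<open>eq\<close> in the form that this criterion expects;
    \<open>emeasure\<close> becomes \<open>measure\<close> because each \<open>\<kappa> y\<close> is
    finite.\<close>
  have eq_h: "(\<integral>\<^sup>+\<omega>. ennreal (indicator A (X \<omega>) * indicator B (X' \<omega>)) * indicator D (Y \<omega>) \<partial>\<Omega>)
      = (\<integral>\<^sup>+\<omega>. ennreal (h A (Y \<omega>) * h B (Y \<omega>)) * indicator D (Y \<omega>) \<partial>\<Omega>)"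
    if A [measurable]: "A \<in> sets M" and B [measurable]: "B \<in> sets M"
      and D [measurable]: "D \<in> sets N" for A B D
  proof -
    have "(\<integral>\<^sup>+\<omega>. ennreal (indicator A (X \<omega>) * indicator B (X' \<omega>)) * indicator D (Y \<omega>) \<partial>\<Omega>)
        = (\<integral>\<^sup>+\<omega>. indicator {\<omega> \<in> space \<Omega>. X \<omega> \<in> A \<and> X' \<omega> \<in> B \<and> Y \<omega> \<in> D} \<omega> \<partial>\<Omega>)"
      by (intro nn_integral_cong) (auto split: split_indicator)
    also have "\<dots> = (\<integral>\<^sup>+\<omega>. emeasure (\<kappa> (Y \<omega>)) A * emeasure (\<kappa> (Y \<omega>)) B * indicator D (Y \<omega>) \<partial>\<Omega>)"
      using eq[OF A B D] by simp
    also have "\<dots> = (\<integral>\<^sup>+\<omega>. ennreal (h A (Y \<omega>) * h B (Y \<omega>)) * indicator D (Y \<omega>) \<partial>\<Omega>)"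
      using prob_space.finite_measure[OF prob(1)[OF Y_space]]
      by (intro nn_integral_cong)
        (simp add: h_def Y_space finite_measure.emeasure_eq_measure ennreal_mult)
    finally show ?thesis .
  qed
  have joint: "AE \<omega> in \<Omega>. ?E (\<lambda>\<omega>. indicator A (X \<omega>) * indicator B (X' \<omega>)) \<omega> = h A (Y \<omega>) * h B (Y \<omega>)"
    if [measurable]: "A \<in> sets M" "B \<in> sets M" for A B
    by (rule real_cond_exp_vimage_algebraI[OF \<Omega> Y, where h = "\<lambda>y. h A y * h B y"])
      (use h eq_h[OF that] in \<open>auto intro!: mult_nonneg_nonneg mult_le_one split: split_indicator\<close>)
  \<comment> \<open>Choosing the whole space for one of the two sets reduces the statements about X
    alone and X' alone to the joint one.\<close>
  have h_space: "h (space M) (Y \<omega>) = 1" if "\<omega> \<in> space \<Omega>" for \<omega>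
    using prob_space.prob_space[OF prob(1)[OF Y_space[OF that]]] prob(3)[OF Y_space[OF that]]
    by (simp add: h_def Y_space[OF that])
  have marg: "AE \<omega> in \<Omega>. ?E (\<lambda>\<omega>. indicator A (X \<omega>)) \<omega> = h A (Y \<omega>)"
    "AE \<omega> in \<Omega>. ?E (\<lambda>\<omega>. indicator A (X' \<omega>)) \<omega> = h A (Y \<omega>)"
    if A [measurable]: "A \<in> sets M" for A
  proof -
    have "(\<integral>\<^sup>+\<omega>. ennreal (indicator A (X \<omega>)) * indicator D (Y \<omega>) \<partial>\<Omega>)
        = (\<integral>\<^sup>+\<omega>. ennreal (h A (Y \<omega>)) * indicator D (Y \<omega>) \<partial>\<Omega>)" if "D \<in> sets N" for D
      using eq_h[OF A sets.top that] measurable_space[OF X']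
      by (simp add: h_space cong: nn_integral_cong_simp)
    then show "AE \<omega> in \<Omega>. ?E (\<lambda>\<omega>. indicator A (X \<omega>)) \<omega> = h A (Y \<omega>)"
      by (intro real_cond_exp_vimage_algebraI[OF \<Omega> Y]) (use h in \<open>auto split: split_indicator\<close>)
    have "(\<integral>\<^sup>+\<omega>. ennreal (indicator A (X' \<omega>)) * indicator D (Y \<omega>) \<partial>\<Omega>)
        = (\<integral>\<^sup>+\<omega>. ennreal (h A (Y \<omega>)) * indicator D (Y \<omega>) \<partial>\<Omega>)" if "D \<in> sets N" for D
      using eq_h[OF sets.top A that] measurable_space[OF X]
      by (simp add: h_space cong: nn_integral_cong_simp)
    then show "AE \<omega> in \<Omega>. ?E (\<lambda>\<omega>. indicator A (X' \<omega>)) \<omega> = h A (Y \<omega>)"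
      by (intro real_cond_exp_vimage_algebraI[OF \<Omega> Y]) (use h in \<open>auto split: split_indicator\<close>)
  qed
  show ?thesis
    unfolding cond_iid_def Let_def
  proof (intro conjI ballI X X' Y)
    fix A B assume A: "A \<in> sets M" and B: "B \<in> sets M"
    show "AE \<omega> in \<Omega>. ?E (\<lambda>\<omega>. indicator A (X \<omega>) * indicator B (X' \<omega>)) \<omega> =
         ?E (\<lambda>\<omega>. indicator A (X \<omega>)) \<omega> * ?E (\<lambda>\<omega>. indicator B (X' \<omega>)) \<omega>"
      using joint[OF A B] marg(1)[OF A] marg(2)[OF B] by eventually_elim simp
    show "AE \<omega> in \<Omega>. ?E (\<lambda>\<omega>. indicator A (X \<omega>)) \<omega> = ?E (\<lambda>\<omega>. indicator A (X' \<omega>)) \<omega>"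
      using marg[OF A] by eventually_elim simp
  qed
qed

section \<open>Factorisation into adjoint kernels gives a forward-backward kernel\<close>

text \<open>\<open>R\<close> draws y from X, then \<open>G\<close> draws X' from y. Being adjoint to
  \<open>R\<close>, \<open>G\<close> is also a version of the conditional law of X given y, so X and
  X' are two independent draws from \<open>G y\<close>.\<close>

lemma forward_backward_kernelI:
  assumes Q: "Q \<in> space (prob_algebra M)" and adj: "adjoint_kernels M Q R G"
    and P: "\<And>x. x \<in> space M \<Longrightarrow> P x = kernel_comp G R x"
  shows "forward_backward_kernel M Q P"
proof -
  note RG = adjoint_kernelsD(1,2)[OF adj]
  have P_markov: "markov_kernel M P"
    using markov_kernel_comp[OF RG] markov_kernel_cong[of M P "kernel_comp G R"] P by blast
  note setsQ = prob_algebra_memD(2,3)[OF Q]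
  define N where "N = prob_algebra M"
  \<comment> \<open>The law of (X, X', Y): draw y from \<open>Q\<close>, take two independent points
    from \<open>G y\<close>, and record the measure \<open>G y\<close> in place of y.\<close>
  define \<Omega> where "\<Omega> = Q \<bind> (\<lambda>y. G y \<Otimes>\<^sub>M (G y \<Otimes>\<^sub>M return N (G y)))"
  have G: "G \<in> M \<rightarrow>\<^sub>M prob_algebra M" by (rule markov_kernelD(1)[OF RG(2)])
  then have G_N: "G \<in> M \<rightarrow>\<^sub>M N" by (simp add: N_def)
  have G_prob: "prob_space (G y)" "sets (G y) = sets M" "space (G y) = space M"
    if "y \<in> space M" for y
    using prob_algebra_memD[OF markov_kernelD(3)[OF RG(2) that]] by auto
  have G_emeasure [measurable]: "(\<lambda>y. emeasure (G y) A) \<in> borel_measurable M" if "A \<in> sets M" for A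
    using measurable_emeasure_kernel[OF markov_kernelD(2)[OF RG(2)] that] .
  have kernel: "(\<lambda>y. G y \<Otimes>\<^sub>M (G y \<Otimes>\<^sub>M return N (G y))) \<in> M \<rightarrow>\<^sub>M prob_algebra (M \<Otimes>\<^sub>M (M \<Otimes>\<^sub>M N))"
    by (intro measurable_pair_prob G measurable_compose[OF G_N measurable_return_prob_space])
  have \<Omega>: "prob_space \<Omega>" and sets_\<Omega> [measurable_cong]: "sets \<Omega> = sets (M \<Otimes>\<^sub>M (M \<Otimes>\<^sub>M N))"
    using prob_space_bind'[OF Q kernel] sets_bind'[OF Q kernel] by (simp_all add: \<Omega>_def)
  have space_\<Omega>: "space \<Omega> = space M \<times> (space M \<times> space N)"
    using sets_eq_imp_space_eq[OF sets_\<Omega>] by (simp add: space_pair_measure)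
  \<comment> \<open>On a box the product measure factorises, and its Dirac component becomes an
    indicator. The law of Y, the conditional independence and the law of (X, X') all follow from
    this formula.\<close>
  have rect: "emeasure \<Omega> (A \<times> (B \<times> D))
      = (\<integral>\<^sup>+y. emeasure (G y) A * emeasure (G y) B * indicator D (G y) \<partial>Q)"
    if [measurable]: "A \<in> sets M" "B \<in> sets M" "D \<in> sets N" for A B D
  proof -
    have "emeasure \<Omega> (A \<times> (B \<times> D))
        = (\<integral>\<^sup>+y. emeasure (G y \<Otimes>\<^sub>M (G y \<Otimes>\<^sub>M return N (G y))) (A \<times> (B \<times> D)) \<partial>Q)"
      unfolding \<Omega>_def by (rule emeasure_bind_prob_algebra[OF Q kernel]) simp
    also have "\<dots> = (\<integral>\<^sup>+y. emeasure (G y) A * emeasure (G y) B * indicator D (G y) \<partial>Q)"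
    proof (rule nn_integral_cong)
      fix y assume "y \<in> space Q"
      then have y: "y \<in> space M" by (simp add: setsQ)
      interpret Gy: prob_space "G y" by (rule G_prob(1)[OF y])
      interpret r: prob_space "return N (G y)"
        by (rule prob_space_return[OF measurable_space[OF G_N y]])
      interpret p: pair_prob_space "G y" "return N (G y)" ..
      have "A \<in> sets (G y)" "B \<in> sets (G y)" "D \<in> sets (return N (G y))"
        using that by (simp_all add: G_prob(2)[OF y])
      then show "emeasure (G y \<Otimes>\<^sub>M (G y \<Otimes>\<^sub>M return N (G y))) (A \<times> (B \<times> D))
          = emeasure (G y) A * emeasure (G y) B * indicator D (G y)"
        by (simp add: p.emeasure_pair_measure_Times r.emeasure_pair_measure_Times mult.assoc)
    qed
    finally show ?thesis .
  qed
  have G_space: "emeasure (G y) (space M) = 1" if "y \<in> space M" for y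
    using prob_space.emeasure_space_1[OF G_prob(1)[OF that]] G_prob(3)[OF that] by simp

  \<comment> \<open>This allows integrals over y under \<open>Q\<close> to be rewritten as integrals
    of functions of Y under \<open>\<Omega>\<close>.\<close>
  have distr_Y: "distr \<Omega> N (\<lambda>\<omega>. snd (snd \<omega>)) = distr Q N G"
  proof (rule measure_eqI)
    fix D assume "D \<in> sets (distr \<Omega> N (\<lambda>\<omega>. snd (snd \<omega>)))"
    then have D [measurable]: "D \<in> sets N" by simp
    have "(\<lambda>\<omega>. snd (snd \<omega>)) -` D \<inter> space \<Omega> = space M \<times> (space M \<times> D)"
      using sets.sets_into_space[OF D] by (auto simp: space_\<Omega>)
    then have "emeasure (distr \<Omega> N (\<lambda>\<omega>. snd (snd \<omega>))) D = emeasure \<Omega> (space M \<times> (space M \<times> D))"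
      by (simp add: emeasure_distr)
    also have "\<dots> = (\<integral>\<^sup>+y. indicator D (G y) \<partial>Q)"
      by (subst rect) (auto intro!: nn_integral_cong simp: G_space setsQ)
    also have "\<dots> = emeasure (distr Q N G) D"
      using G_N by (simp add: setsQ nn_integral_distr flip: nn_integral_indicator cong: measurable_cong_sets)
    finally show "emeasure (distr \<Omega> N (\<lambda>\<omega>. snd (snd \<omega>))) D = emeasure (distr Q N G) D" .
  qed simp

  have "cond_iid \<Omega> M N fst (\<lambda>\<omega>. fst (snd \<omega>)) (\<lambda>\<omega>. snd (snd \<omega>))"
  \<comment> \<open>The value of Y is itself the conditional law, so the kernel from Y to the points
    is the identity.\<close>
  proof (rule cond_iidI[OF \<Omega>, where \<kappa> = "\<lambda>m. m"])
    show "(\<lambda>m. m) \<in> N \<rightarrow>\<^sub>M prob_algebra M" by (simp add: N_def)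
    fix A B D assume A [measurable]: "A \<in> sets M" and B [measurable]: "B \<in> sets M"
      and D [measurable]: "D \<in> sets N"
    have N_emeasure [measurable]: "(\<lambda>m. emeasure m C) \<in> borel_measurable N" if "C \<in> sets M" for C
      unfolding N_def prob_algebra_def
      by (intro measurable_restrict_space1 measurable_emeasure_subprob_algebra that)
    have "{\<omega> \<in> space \<Omega>. fst \<omega> \<in> A \<and> fst (snd \<omega>) \<in> B \<and> snd (snd \<omega>) \<in> D} = A \<times> (B \<times> D)"
      using sets.sets_into_space[OF A] sets.sets_into_space[OF B] sets.sets_into_space[OF D]
      by (auto simp: space_\<Omega>)
    then have "emeasure \<Omega> {\<omega> \<in> space \<Omega>. fst \<omega> \<in> A \<and> fst (snd \<omega>) \<in> B \<and> snd (snd \<omega>) \<in> D}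
        = (\<integral>\<^sup>+y. emeasure (G y) A * emeasure (G y) B * indicator D (G y) \<partial>Q)"
      using rect[OF A B D] by simp
    also have "\<dots> = (\<integral>\<^sup>+m. emeasure m A * emeasure m B * indicator D m \<partial>distr Q N G)"
      using G_N by (subst nn_integral_distr) (auto simp: setsQ cong: measurable_cong_sets)
    also have "\<dots> = (\<integral>\<^sup>+\<omega>. emeasure (snd (snd \<omega>)) A * emeasure (snd (snd \<omega>)) B
        * indicator D (snd (snd \<omega>)) \<partial>\<Omega>)"
      unfolding distr_Y[symmetric] by (subst nn_integral_distr) auto
    finally show "emeasure \<Omega> {\<omega> \<in> space \<Omega>. fst \<omega> \<in> A \<and> fst (snd \<omega>) \<in> B \<and> snd (snd \<omega>) \<in> D}
        = (\<integral>\<^sup>+\<omega>. emeasure (snd (snd \<omega>)) A * emeasure (snd (snd \<omega>)) B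
            * indicator D (snd (snd \<omega>)) \<partial>\<Omega>)" .
  qed measurable

  moreover have "distr \<Omega> (M \<Otimes>\<^sub>M M) (\<lambda>\<omega>. (fst \<omega>, fst (snd \<omega>))) = joint_law M Q P"
  proof (rule emeasure_eq_on_rectanglesI)
    show "finite_measure (distr \<Omega> (M \<Otimes>\<^sub>M M) (\<lambda>\<omega>. (fst \<omega>, fst (snd \<omega>))))"
      by (intro prob_space.finite_measure prob_space.prob_space_distr[OF \<Omega>]) measurable
    show "sets (joint_law M Q P) = sets (M \<Otimes>\<^sub>M M)"
      by (rule prob_algebra_memD(2)[OF joint_law_in_prob_algebra[OF Q P_markov]])
    fix A B assume A [measurable]: "A \<in> sets M" and B [measurable]: "B \<in> sets M"
    have "(\<lambda>\<omega>. (fst \<omega>, fst (snd \<omega>))) -` (A \<times> B) \<inter> space \<Omega> = A \<times> (B \<times> space N)"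
      using sets.sets_into_space[OF A] sets.sets_into_space[OF B] by (auto simp: space_\<Omega>)
    then have "emeasure (distr \<Omega> (M \<Otimes>\<^sub>M M) (\<lambda>\<omega>. (fst \<omega>, fst (snd \<omega>)))) (A \<times> B)
        = emeasure \<Omega> (A \<times> (B \<times> space N))"
      by (simp add: emeasure_distr)
    also have "\<dots> = (\<integral>\<^sup>+y. emeasure (G y) A * emeasure (G y) B \<partial>Q)"
      using measurable_space[OF G_N] by (subst rect) (auto intro!: nn_integral_cong simp: setsQ)
    also have "\<dots> = (\<integral>\<^sup>+y. (\<integral>\<^sup>+x. indicator A x \<partial>G y) * emeasure (G y) B \<partial>Q)"
      by (intro nn_integral_cong) (simp add: setsQ G_prob)
    \<comment> \<open>Adjointness enters here, with the indicator of A and the function y to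
      \<open>emeasure (G y) B\<close> as test functions: the mixture over y becomes an integral over
      the starting point x.\<close>
    also have "\<dots> = (\<integral>\<^sup>+x. indicator A x * (\<integral>\<^sup>+y. emeasure (G y) B \<partial>R x) \<partial>Q)"
      by (rule adjoint_kernelsD(3)[OF adj, symmetric]) measurable
    also have "\<dots> = (\<integral>\<^sup>+x. indicator A x * emeasure (P x) B \<partial>Q)"
    proof (rule nn_integral_cong)
      fix x assume "x \<in> space Q"
      then have x: "x \<in> space M" by (simp add: setsQ)
      have "emeasure (P x) B = (\<integral>\<^sup>+y. emeasure (G y) B \<partial>R x)"
        unfolding P[OF x] kernel_comp_def
        by (rule emeasure_bind_prob_algebra[OF markov_kernelD(3)[OF RG(1) x] G B])
      then show "indicator A x * (\<integral>\<^sup>+y. emeasure (G y) B \<partial>R x) = indicator A x * emeasure (P x) B"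
        by simp
    qed
    also have "\<dots> = emeasure (joint_law M Q P) (A \<times> B)"
      by (rule emeasure_joint_law_Times[OF Q P_markov A B, symmetric])
    finally show "emeasure (distr \<Omega> (M \<Otimes>\<^sub>M M) (\<lambda>\<omega>. (fst \<omega>, fst (snd \<omega>)))) (A \<times> B)
        = emeasure (joint_law M Q P) (A \<times> B)" .
  qed simp
  ultimately show ?thesis
    unfolding forward_backward_kernel_def using P_markov \<Omega>
    by (intro conjI exI[of _ \<Omega>] exI[of _ fst] exI[of _ "\<lambda>\<omega>. fst (snd \<omega>)"] exI[of _ N]
        exI[of _ "\<lambda>\<omega>. snd (snd \<omega>)"]) (auto simp: cond_iid_def)
qed

section \<open>Powers of self-adjoint kernels\<close>

text \<open>The r-th power is again self-adjoint and serves as both factors. This covers reversible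
  chains as well as even powers of a composition \<open>kernel_comp L K\<close>.\<close>

lemma forward_backward_kernel_pow_self_adjoint:
  assumes Q: "Q \<in> space (prob_algebra M)" and adj: "adjoint_kernels M Q K K"
  shows "forward_backward_kernel M Q (kernel_pow M K (2 * r))"
  using kernel_pow_add[OF adjoint_kernelsD(1)[OF adj], of _ r r]
  by (intro forward_backward_kernelI[OF Q adjoint_kernels_pow[OF Q adj]]) (simp add: mult_2)

text \<open>The composition is self-adjoint because taking adjoints swaps \<open>K\<close> and
  \<open>L\<close> and also reverses their order. An odd power is cut in the middle of its central
  factor.\<close>

lemma forward_backward_kernel_pow_comp_adjoint:
  assumes Q: "Q \<in> space (prob_algebra M)" and adj: "adjoint_kernels M Q K L"
  shows "forward_backward_kernel M Q (kernel_pow M (kernel_comp L K) r)"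
proof -
  let ?S = "kernel_comp L K"
  note KL = adjoint_kernelsD(1,2)[OF adj]
  have S: "adjoint_kernels M Q ?S ?S"
    by (rule adjoint_kernels_comp[OF Q adj adjoint_kernels_sym[OF adj]])
  note S_pow = markov_kernel_pow[OF adjoint_kernelsD(1)[OF S]]
  show ?thesis
  proof (cases "even r")
    case True
    then show ?thesis
      using forward_backward_kernel_pow_self_adjoint[OF Q S] by (auto elim!: evenE)
  next
    case False
    \<comment> \<open>The extra factor is put into the second summand, so that the power
      \<open>Suc k\<close> unfolds to the central factor after k others.\<close>
    then obtain k where r: "r = k + Suc k" by (metis mult_2 oddE add_Suc_right Suc_eq_plus1)
    show ?thesis
    \<comment> \<open>The first factor takes k steps of \<open>?S\<close> and then \<open>K\<close>;
      its adjoint takes \<open>L\<close> and then k steps of \<open>?S\<close>.\<close>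
    proof (rule forward_backward_kernelI[OF Q adjoint_kernels_comp[OF Q adjoint_kernels_pow[OF Q S] adj]])
      fix x assume x: "x \<in> space M"
      have "kernel_pow M ?S r x = kernel_comp (kernel_pow M ?S k) (kernel_comp ?S (kernel_pow M ?S k)) x"
        using kernel_pow_add[OF adjoint_kernelsD(1)[OF S] x, of k "Suc k"] by (simp add: r)
      \<comment> \<open>The central factor is split: \<open>K\<close> stays with the k steps before
        it, and \<open>L\<close> is left to join the k steps after it.\<close>
      also have "\<dots> = kernel_comp (kernel_pow M ?S k) (kernel_comp L (kernel_comp K (kernel_pow M ?S k))) x"
        by (rule kernel_comp_cong[OF markov_kernel_comp[OF S_pow adjoint_kernelsD(1)[OF S]] x])
          (use kernel_comp_assoc[OF S_pow KL x] in auto)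
      also have "\<dots> = kernel_comp (kernel_comp (kernel_pow M ?S k) L) (kernel_comp K (kernel_pow M ?S k)) x"
        by (rule kernel_comp_assoc[OF markov_kernel_comp[OF S_pow KL(1)] KL(2) S_pow x, symmetric])
      finally show "kernel_pow M ?S r x
          = kernel_comp (kernel_comp (kernel_pow M ?S k) L) (kernel_comp K (kernel_pow M ?S k)) x" .
    qed
  qed
qed

section \<open>The three families of kernels\<close>

theorem proposition6:
  fixes M :: "'a measure" and \<pi> :: "'a \<Rightarrow> 'a measure" and Q0 :: "'a measure"
  assumes "standard_borel M"
    and "markov_kernel M \<pi>"
    and "stationary M \<pi> Q0"
  shows
    "(\<forall>r s. r \<ge> 1 \<longrightarrow> s = 2 * r \<longrightarrow> reversible M Q0 \<pi> \<longrightarrow>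
        forward_backward_kernel M Q0 (kernel_pow M \<pi> s)) \<and>
     (\<forall>\<pi>_inv r. reverse_kernel M Q0 \<pi> \<pi>_inv \<longrightarrow> r \<ge> 1 \<longrightarrow>
        forward_backward_kernel M Q0 (kernel_comp (kernel_pow M \<pi> r) (kernel_pow M \<pi>_inv r))) \<and>
     (\<forall>\<pi>_inv r. reverse_kernel M Q0 \<pi> \<pi>_inv \<longrightarrow> r \<ge> 1 \<longrightarrow>
        forward_backward_kernel M Q0 (kernel_pow M (kernel_comp \<pi>_inv \<pi>) r))"
proof -
  have Q: "Q0 \<in> space (prob_algebra M)" using assms(3) by (simp add: stationary_def)
  note adj = reverse_kernel_imp_adjoint[OF Q assms(2)]
  have "forward_backward_kernel M Q0 (kernel_pow M \<pi> (2 * r))" if rev: "reversible M Q0 \<pi>" for r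
  proof -
    obtain L where L: "reverse_kernel M Q0 \<pi> L" "AE x in Q0. \<pi> x = L x"
      using rev by (auto simp: reversible_def)
    show ?thesis
      \<comment> \<open>Reversibility only provides a reverse kernel \<open>L\<close> equal to
        \<open>\<pi>\<close> almost everywhere; replacing \<open>L\<close> by \<open>\<pi>\<close>
        shows that \<open>\<pi>\<close> is adjoint to itself.\<close>
      using adjoint_kernels_cong_AE[OF adj[OF L(1)] assms(2) L(2)]
      by (rule forward_backward_kernel_pow_self_adjoint[OF Q])
  qed
  \<comment> \<open>The factor run first is the backward power, so the adjoint pair is used with its
    two kernels exchanged.\<close>
  moreover have "forward_backward_kernel M Q0 (kernel_comp (kernel_pow M \<pi> r) (kernel_pow M L r))"
    if "reverse_kernel M Q0 \<pi> L" for L r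
    by (rule forward_backward_kernelI[OF Q
          adjoint_kernels_pow[OF Q adjoint_kernels_sym[OF adj[OF that]]] refl])
  moreover have "forward_backward_kernel M Q0 (kernel_pow M (kernel_comp L \<pi>) r)"
    if "reverse_kernel M Q0 \<pi> L" for L r
    by (rule forward_backward_kernel_pow_comp_adjoint[OF Q adj[OF that]])
  ultimately show ?thesis by blast
qed

end
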